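(* Let $X$ be a set of cardinality $|X|\ge 3$ and let $G=S(X)$ be the symmetric group of $X$. The centralizer topology $\mathfrak T_G$ on $G$ is discrete if and only if $|X|\le\mathfrak c$.
   Context: $S(X)$ is the group of all bijections of $X$ under composition. $\mathfrak c$ is the cardinality of the continuum. For a group $G$, the centralizer topology $\mathfrak T_G$ is the topology generated by the sub-base consisting of the sets $\{x\in G: xbx^{-1}=aba^{-1}\}$, where $a,b\in G$. *)

theory Defs
  imports
    "HOL-Algebra.Bij"
    "HOL-Analysis.Abstract_Topology"
    "HOL-Library.Equipollence"
begin

definition centralizer_topology :: "('a, 'b) monoid_scheme \<Rightarrow> 'a topology"
  where "centralizer_topology G =
    topology_generated_by
      {{x \<in> carrier G. x \<otimes>\<^bsub>G\<^esub> b \<otimes>\<^bsub>G\<^esub> inv\<^bsub>G\<^esub> x = a \<otimes>\<^bsub>G\<^esub> b \<otimes>\<^bsub>G\<^esub> inv\<^bsub>G\<^esub> a} | a b.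
        a \<in> carrier G \<and> b \<in> carrier G}"

text \<open>
  The topology generated by a family lives on the union of that family. For a group this union
  is the whole carrier, since each \<open>a\<close> lies in the set given by \<open>a\<close> and any \<open>b\<close>.
\<close>

lemma topspace_centralizer_topology:
  assumes "group G"
  shows "topspace (centralizer_topology G) = carrier G"
proof -
  interpret group G by (rule assms)
  show ?thesis
    unfolding centralizer_topology_def topology_generated_by_topspace by blast
qed

end

theory Submission
  imports Defs "HOL-Algebra.Generated_Groups" "HOL-Analysis.Abstract_Topology_2"
begin

text \<open>
  The topology is discrete iff some finite \<open>F \<subseteq> S(X)\<close> has trivial centralizer.

  If \<open>F\<close> is finite, it generates a countable subgroup \<open>H\<close>, which has at most continuum many
  subsets. When \<open>|X|\<close> exceeds the continuum, two distinct points therefore have the same stabilizer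
  in \<open>H\<close>, and exchanging \<open>h x\<close> with \<open>h y\<close> for all \<open>h \<in> H\<close> gives a nontrivial permutation commuting
  with \<open>H\<close>.

  If \<open>X\<close> is finite, \<open>F\<close> can be all of \<open>S(X)\<close>, whose center is trivial. If \<open>X\<close> is infinite of size at
  most continuum, identify it with \<open>X \<times> \<int>\<close> and choose distinct sets \<open>A y \<subseteq> \<int>\<close> for \<open>y \<in> X\<close>. A
  permutation commuting with the shift on \<open>\<int>\<close> maps fibres to fibres by translations. The involution
  exchanging \<open>0\<close> and \<open>1\<close> in every fibre forces these translations to be trivial, and the one
  exchanging \<open>2m\<close> and \<open>2m + 1\<close> in the fibre of \<open>y\<close> for \<open>m \<in> A y\<close> forces every fibre to be mapped
  to itself.
\<close>

section \<open>Discreteness and trivial centralizers\<close>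

text \<open>A subbasic set given by \<open>c\<close> and \<open>b\<close> that contains
  \<open>a\<close> does not change when \<open>c\<close> is replaced by \<open>a\<close>.
  Neighbourhoods of \<open>a\<close> are therefore controlled by a finite set of elements
  \<open>b\<close>, all conjugated by \<open>a\<close> itself.\<close>

lemma (in group) generate_centralizer_topology_nbhd:
  assumes "generate_topology_on
      {{x \<in> carrier G. x \<otimes> b \<otimes> inv x = a \<otimes> b \<otimes> inv a} | a b. a \<in> carrier G \<and> b \<in> carrier G} U"
    and "a \<in> U"
  shows "\<exists>F. finite F \<and> F \<subseteq> carrier G \<and>
    (\<forall>x\<in>carrier G. (\<forall>b\<in>F. x \<otimes> b \<otimes> inv x = a \<otimes> b \<otimes> inv a) \<longrightarrow> x \<in> U)"
  using assms
proof (induction rule: generate_topology_on.induct)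
  case Empty
  then show ?case by simp
next
  case (Int U V)
  then obtain F E where
    "finite F" "F \<subseteq> carrier G"
    "\<forall>x\<in>carrier G. (\<forall>b\<in>F. x \<otimes> b \<otimes> inv x = a \<otimes> b \<otimes> inv a) \<longrightarrow> x \<in> U"
    "finite E" "E \<subseteq> carrier G"
    "\<forall>x\<in>carrier G. (\<forall>b\<in>E. x \<otimes> b \<otimes> inv x = a \<otimes> b \<otimes> inv a) \<longrightarrow> x \<in> V"
    by auto
  then show ?case
    by (intro exI[of _ "F \<union> E"]) auto
next
  case (UN K)
  then obtain U where "U \<in> K" "a \<in> U" by blast
  with UN.IH[of U] show ?case by blast
next
  case (Basis U)
  then obtain c b where cb: "c \<in> carrier G" "b \<in> carrier G"
    "U = {x \<in> carrier G. x \<otimes> b \<otimes> inv x = c \<otimes> b \<otimes> inv c}" by blast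
  with Basis.prems show ?case
    by (intro exI[of _ "{b}"]) auto
qed

text \<open>The equation x b x^-1 = a b a^-1 says that a^-1 x commutes with \<open>b\<close>. The
  basic neighbourhoods of \<open>a\<close> are thus the cosets a C, where C is the centralizer of a
  finite set, and such a coset is a singleton iff C is trivial.\<close>

lemma (in group) centralizer_topology_discrete_iff:
  "centralizer_topology G = discrete_topology (carrier G) \<longleftrightarrow>
    (\<exists>F. finite F \<and> F \<subseteq> carrier G \<and>
      (\<forall>x\<in>carrier G. (\<forall>b\<in>F. x \<otimes> b = b \<otimes> x) \<longrightarrow> x = \<one>))"
  (is "?L \<longleftrightarrow> ?R")
proof
  assume ?L
  then have "openin (centralizer_topology G) {\<one>}" by simp
  then obtain F where F: "finite F" "F \<subseteq> carrier G"
    and triv: "\<And>x. x \<in> carrier G \<Longrightarrow> (\<forall>b\<in>F. x \<otimes> b \<otimes> inv x = \<one> \<otimes> b \<otimes> inv \<one>) \<Longrightarrow> x = \<one>"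
    using generate_centralizer_topology_nbhd[of "{\<one>}" \<one>]
    unfolding centralizer_topology_def openin_topology_generated_by_iff by blast
  have "x = \<one>" if x: "x \<in> carrier G" and comm: "\<forall>b\<in>F. x \<otimes> b = b \<otimes> x" for x
  proof (rule triv[OF x], rule ballI)
    fix b assume "b \<in> F"
    with F comm x show "x \<otimes> b \<otimes> inv x = \<one> \<otimes> b \<otimes> inv \<one>"
      by (simp add: subset_iff m_assoc)
  qed
  with F show ?R by blast
next
  assume ?R
  then obtain F where F: "finite F" "F \<subseteq> carrier G"
    and triv: "\<And>x. x \<in> carrier G \<Longrightarrow> (\<forall>b\<in>F. x \<otimes> b = b \<otimes> x) \<Longrightarrow> x = \<one>" by blast
  define N where "N a b = {x \<in> carrier G. x \<otimes> b \<otimes> inv x = a \<otimes> b \<otimes> inv a}" for a b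
  have open_N: "openin (centralizer_topology G) (N a b)"
    if "a \<in> carrier G" "b \<in> carrier G" for a b
    unfolding centralizer_topology_def N_def
    by (rule topology_generated_by_Basis) (use that in blast)
  have "openin (centralizer_topology G) {a}" if a: "a \<in> carrier G" for a
  proof -
    have cancel: "inv a \<otimes> (a \<otimes> z) = z" if "z \<in> carrier G" for z
      using a that by (simp add: m_assoc[symmetric])
    have "x = a" if x: "x \<in> carrier G" and eq: "\<And>b. b \<in> F \<Longrightarrow> x \<in> N a b" for x
    proof -
      have "inv a \<otimes> x = \<one>"
      proof (rule triv)
        show "\<forall>b\<in>F. inv a \<otimes> x \<otimes> b = b \<otimes> (inv a \<otimes> x)"
        proof
          fix b assume b: "b \<in> F"
          then have bG: "b \<in> carrier G" using F by blast
          have "x \<otimes> b \<otimes> inv x = a \<otimes> b \<otimes> inv a" using eq[OF b] by (simp add: N_def)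
          then have "inv a \<otimes> (x \<otimes> b \<otimes> inv x) \<otimes> x = inv a \<otimes> (a \<otimes> b \<otimes> inv a) \<otimes> x" by simp
          then show "inv a \<otimes> x \<otimes> b = b \<otimes> (inv a \<otimes> x)"
            using a x bG by (simp add: m_assoc cancel)
        qed
      qed (use a x in simp)
      then have "a \<otimes> (inv a \<otimes> x) = a" using a by simp
      then show ?thesis using a x by (simp add: m_assoc[symmetric])
    qed
    \<comment> \<open>\<open>N a \<one>\<close> is the whole carrier. Inserting
      \<open>\<one>\<close> keeps the intersection inside the carrier, and its family nonempty, even
      if \<open>F\<close> is empty.\<close>
    then have "{a} = \<Inter> (N a ` insert \<one> F)"
      using a by (auto simp: N_def)
    moreover have "openin (centralizer_topology G) (\<Inter> (N a ` insert \<one> F))"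
      by (rule openin_Inter) (use F a open_N in auto)
    ultimately show ?thesis by simp
  qed
  then show ?L
    using topspace_centralizer_topology[OF group_axioms]
    by (auto simp: eq_commute[of "centralizer_topology G"] discrete_topology_unique)
qed

section \<open>Permutation groups\<close>

lemma carrier_BijGroup [simp]: "carrier (BijGroup X) = Bij X"
  by (simp add: BijGroup_def)

lemma one_BijGroup_apply [simp]: "z \<in> X \<Longrightarrow> \<one>\<^bsub>BijGroup X\<^esub> z = z"
  by (simp add: BijGroup_def)

lemma mult_BijGroup_apply [simp]:
  "\<lbrakk>f \<in> Bij X; g \<in> Bij X; z \<in> X\<rbrakk> \<Longrightarrow> (f \<otimes>\<^bsub>BijGroup X\<^esub> g) z = f (g z)"
  by (simp add: BijGroup_def compose_def)

lemma Bij_apply_closed: "\<lbrakk>f \<in> Bij X; z \<in> X\<rbrakk> \<Longrightarrow> f z \<in> X"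
  using Bij_imp_funcset by blast

lemma Bij_apply_eq_iff: "\<lbrakk>f \<in> Bij X; w \<in> X; z \<in> X\<rbrakk> \<Longrightarrow> f w = f z \<longleftrightarrow> w = z"
  by (auto simp: Bij_def bij_betw_def dest: inj_onD)

lemma Bij_eqI: "\<lbrakk>f \<in> Bij X; g \<in> Bij X; \<And>z. z \<in> X \<Longrightarrow> f z = g z\<rbrakk> \<Longrightarrow> f = g"
  by (auto intro: extensionalityI dest: Bij_imp_extensional)

lemma restrict_in_BijI:
  assumes "\<And>z. z \<in> X \<Longrightarrow> f z \<in> X" "\<And>z. z \<in> X \<Longrightarrow> g z \<in> X"
    and "\<And>z. z \<in> X \<Longrightarrow> g (f z) = z" "\<And>z. z \<in> X \<Longrightarrow> f (g z) = z"
  shows "restrict f X \<in> Bij X"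
proof -
  have "bij_betw f X X"
    by (rule bij_betw_byWitness[where f' = g]) (use assms in auto)
  then show ?thesis by (simp add: Bij_def cong: bij_betw_cong)
qed

lemma BijGroup_commute_iff:
  assumes "f \<in> Bij X" "g \<in> Bij X"
  shows "f \<otimes>\<^bsub>BijGroup X\<^esub> g = g \<otimes>\<^bsub>BijGroup X\<^esub> f \<longleftrightarrow> (\<forall>z\<in>X. f (g z) = g (f z))"
proof
  assume "f \<otimes>\<^bsub>BijGroup X\<^esub> g = g \<otimes>\<^bsub>BijGroup X\<^esub> f"
  then show "\<forall>z\<in>X. f (g z) = g (f z)"
    using assms by (metis mult_BijGroup_apply)
next
  assume eq: "\<forall>z\<in>X. f (g z) = g (f z)"
  interpret group "BijGroup X" by (rule group_BijGroup)
  show "f \<otimes>\<^bsub>BijGroup X\<^esub> g = g \<otimes>\<^bsub>BijGroup X\<^esub> f"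
    by (rule Bij_eqI[where X = X]) (use assms eq m_closed in auto)
qed

text \<open>The pointwise form in which both directions of the theorem are proved. Members of
  \<open>Bij X\<close> are extensional, so fixing every point of \<open>X\<close> already makes one
  of them equal to the identity of the group.\<close>

lemma BijGroup_discrete_iff:
  "centralizer_topology (BijGroup X) = discrete_topology (carrier (BijGroup X)) \<longleftrightarrow>
    (\<exists>F. finite F \<and> F \<subseteq> Bij X \<and>
      (\<forall>f\<in>Bij X. (\<forall>b\<in>F. \<forall>z\<in>X. f (b z) = b (f z)) \<longrightarrow> (\<forall>z\<in>X. f z = z)))"
proof -
  interpret group "BijGroup X" by (rule group_BijGroup)
  have one: "f = \<one>\<^bsub>BijGroup X\<^esub> \<longleftrightarrow> (\<forall>z\<in>X. f z = z)" if "f \<in> Bij X" for f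
  proof
    show "f = \<one>\<^bsub>BijGroup X\<^esub>" if "\<forall>z\<in>X. f z = z"
      by (rule Bij_eqI[OF \<open>f \<in> Bij X\<close> one_closed[unfolded carrier_BijGroup]]) (use that in simp)
  qed simp
  have "(\<forall>b\<in>F. f \<otimes>\<^bsub>BijGroup X\<^esub> b = b \<otimes>\<^bsub>BijGroup X\<^esub> f) \<longleftrightarrow> (\<forall>b\<in>F. \<forall>z\<in>X. f (b z) = b (f z))"
    if "F \<subseteq> Bij X" "f \<in> Bij X" for F f
    using that by (simp add: BijGroup_commute_iff subset_iff)
  then show ?thesis
    unfolding centralizer_topology_discrete_iff
    unfolding carrier_BijGroup
    by (intro ex_cong1 conj_cong refl ball_cong) (simp only: one)
qed

section \<open>Countable groups of permutations of a large set\<close>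

text \<open>Every element of the generated subgroup is the value of a finite word in the letters
  \<open>F\<close> and their inverses, and a countable alphabet has only countably many
  words.\<close>

lemma (in group) countable_generate:
  assumes "countable F" "F \<subseteq> carrier G"
  shows "countable (generate G F)"
proof -
  define W where "W = lists (F \<union> m_inv G ` F)"
  define val where "val w = foldr (\<otimes>) w \<one>" for w
  have W_carrier: "set w \<subseteq> carrier G" if "w \<in> W" for w
    using that assms unfolding W_def by (auto simp: in_lists_conv_set)
  have val_closed: "val w \<in> carrier G" if "set w \<subseteq> carrier G" for w
    using that unfolding val_def by (induction w) auto
  have val_append: "val (u @ v) = val u \<otimes> val v"
    if "set u \<subseteq> carrier G" "set v \<subseteq> carrier G" for u v
    using that(1)
  proof (induction u)
    case Nil
    then show ?case using val_closed[OF that(2)] by (simp add: val_def)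
  next
    case (Cons a u)
    then show ?case
      using val_closed[OF that(2)] val_closed[of u] by (auto simp: val_def m_assoc)
  qed
  have "g \<in> val ` W" if "g \<in> generate G F" for g
    using that
  proof induction
    case one
    then show ?case by (intro image_eqI[of _ _ "[]"]) (auto simp: val_def W_def)
  next
    case (incl h)
    then show ?case using assms by (intro image_eqI[of _ _ "[h]"]) (auto simp: val_def W_def)
  next
    case (inv h)
    then show ?case using assms by (intro image_eqI[of _ _ "[inv h]"]) (auto simp: val_def W_def)
  next
    case (eng g h)
    then obtain u v where "u \<in> W" "v \<in> W" "g = val u" "h = val v" by blast
    moreover from this have "u @ v \<in> W" by (simp add: W_def)
    ultimately show ?case
      using val_append W_carrier by (metis imageI)
  qed
  moreover have "countable (val ` W)"
    unfolding W_def using assms by auto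
  ultimately show ?thesis by (meson countable_subset subsetI)
qed

section \<open>Exchanging the orbits of two points with equal stabilizers\<close>

text \<open>
  The orbits of \<open>x\<close> and \<open>y\<close> may coincide; then the second case never applies. The value does not
  depend on the choice of \<open>h\<close> when \<open>x\<close> and \<open>y\<close> have the same stabilizer.
\<close>

definition orbit_exchange :: "('a \<Rightarrow> 'a) set \<Rightarrow> 'a \<Rightarrow> 'a \<Rightarrow> 'a \<Rightarrow> 'a"
  where "orbit_exchange H x y z =
    (if \<exists>h\<in>H. z = h x then (SOME h. h \<in> H \<and> z = h x) y
     else if \<exists>h\<in>H. z = h y then (SOME h. h \<in> H \<and> z = h y) x
     else z)"

text \<open>Equality of the stabilizers of \<open>x\<close> and \<open>y\<close> in \<open>H\<close>
  makes h x \<mapsto> h y a well-defined isomorphism of \<open>H\<close>-sets between the two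
  orbits.\<close>

locale same_stabilizer =
  fixes X :: "'a set" and H x y
  assumes subgroup: "subgroup H (BijGroup X)"
    and points: "x \<in> X" "y \<in> X"
    and stabilizer_eq: "\<And>h. h \<in> H \<Longrightarrow> h x = x \<longleftrightarrow> h y = y"
begin

sublocale group "BijGroup X" by (rule group_BijGroup)

lemma in_Bij: "h \<in> H \<Longrightarrow> h \<in> Bij X"
  using subgroup.subset[OF subgroup] by auto

lemma closed: "\<lbrakk>h \<in> H; z \<in> X\<rbrakk> \<Longrightarrow> h z \<in> X"
  by (rule Bij_apply_closed[OF in_Bij])

lemma mult_in: "\<lbrakk>g \<in> H; h \<in> H\<rbrakk> \<Longrightarrow> \<exists>k\<in>H. \<forall>z\<in>X. k z = g (h z)"
  by (intro bexI[of _ "g \<otimes>\<^bsub>BijGroup X\<^esub> h"])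
    (simp_all add: in_Bij subgroup.m_closed[OF subgroup])

lemma inverse_in:
  assumes "h \<in> H"
  shows "\<exists>k\<in>H. (\<forall>z\<in>X. k (h z) = z) \<and> (\<forall>z\<in>X. h (k z) = z)"
proof (intro bexI[of _ "inv\<^bsub>BijGroup X\<^esub> h"] conjI ballI)
  show inv: "inv\<^bsub>BijGroup X\<^esub> h \<in> H"
    using subgroup.m_inv_closed[OF subgroup assms] .
  fix z assume z: "z \<in> X"
  show "(inv\<^bsub>BijGroup X\<^esub> h) (h z) = z" "h ((inv\<^bsub>BijGroup X\<^esub> h) z) = z"
    using mult_BijGroup_apply[OF in_Bij[OF inv] in_Bij[OF assms] z]
      mult_BijGroup_apply[OF in_Bij[OF assms] in_Bij[OF inv] z] in_Bij[OF assms] z by simp_all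
qed

lemma one_in: "\<exists>h\<in>H. \<forall>z\<in>X. h z = z"
  by (intro bexI[of _ "\<one>\<^bsub>BijGroup X\<^esub>"]) (simp_all add: subgroup.one_closed[OF subgroup])

text \<open>Two elements agree at a point iff h^-1 g stabilizes it, and the two stabilizers
  coincide.\<close>

lemma apply_eq_iff:
  assumes "g \<in> H" "h \<in> H"
  shows "g x = h x \<longleftrightarrow> g y = h y"
proof -
  obtain k where k: "k \<in> H" "\<forall>z\<in>X. k (h z) = z" "\<forall>z\<in>X. h (k z) = z"
    using inverse_in[OF assms(2)] by blast
  obtain l where l: "l \<in> H" "\<forall>z\<in>X. l z = k (g z)"
    using mult_in[OF k(1) assms(1)] by blast
  have "g z = h z \<longleftrightarrow> l z = z" if "z \<in> X" for z
    using that k l closed assms by metis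
  then show ?thesis using stabilizer_eq[OF l(1)] points by simp
qed

lemma exchange_fst:
  assumes h: "h \<in> H"
  shows "orbit_exchange H x y (h x) = h y"
proof -
  define k where "k = (SOME g. g \<in> H \<and> h x = g x)"
  have "k \<in> H \<and> h x = k x"
    unfolding k_def by (rule someI[of _ h]) (use h in simp)
  moreover have "orbit_exchange H x y (h x) = k y"
    using h unfolding orbit_exchange_def k_def by auto
  ultimately show ?thesis
    using apply_eq_iff h by metis
qed

lemma exchange_snd:
  assumes h: "h \<in> H" and "\<not> (\<exists>g\<in>H. h y = g x)"
  shows "orbit_exchange H x y (h y) = h x"
proof -
  define k where "k = (SOME g. g \<in> H \<and> h y = g y)"
  have "k \<in> H \<and> h y = k y"
    unfolding k_def by (rule someI[of _ h]) (use h in simp)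
  moreover have "orbit_exchange H x y (h y) = k x"
    using assms unfolding orbit_exchange_def k_def by auto
  ultimately show ?thesis
    using apply_eq_iff h by metis
qed

lemma exchange_other:
  "\<lbrakk>\<not> (\<exists>g\<in>H. z = g x); \<not> (\<exists>g\<in>H. z = g y)\<rbrakk> \<Longrightarrow> orbit_exchange H x y z = z"
  unfolding orbit_exchange_def by auto

lemma orbit_translate_iff:
  assumes "h \<in> H" "z \<in> X" "w \<in> X"
  shows "(\<exists>g\<in>H. h z = g w) \<longleftrightarrow> (\<exists>g\<in>H. z = g w)"
  using assms inverse_in[OF assms(1)] mult_in by metis

lemma orbit_sym:
  assumes "z \<in> X" "w \<in> X"
  shows "(\<exists>g\<in>H. z = g w) \<longleftrightarrow> (\<exists>g\<in>H. w = g z)"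
  using assms inverse_in by metis

lemma exchange_closed: "z \<in> X \<Longrightarrow> orbit_exchange H x y z \<in> X"
  by (metis exchange_fst exchange_snd exchange_other closed points)

text \<open>Orbits are invariant under \<open>h\<close>, so \<open>h z\<close> falls under the same
  case of the definition as \<open>z\<close>. On the two orbits, both sides come from the product of
  \<open>h\<close> with an element carrying \<open>x\<close> or \<open>y\<close> to
  \<open>z\<close>.\<close>

lemma exchange_commute:
  assumes h: "h \<in> H" and z: "z \<in> X"
  shows "orbit_exchange H x y (h z) = h (orbit_exchange H x y z)"
proof -
  consider (fst) g where "g \<in> H" "z = g x"
    | (snd) g where "g \<in> H" "z = g y" "\<not> (\<exists>g\<in>H. z = g x)"
    | (other) "\<not> (\<exists>g\<in>H. z = g x)" "\<not> (\<exists>g\<in>H. z = g y)" by blast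
  then show ?thesis
  proof cases
    case fst
    obtain k where k: "k \<in> H" "\<forall>z\<in>X. k z = h (g z)" using mult_in[OF h fst(1)] by blast
    then show ?thesis using fst exchange_fst points by metis
  next
    case snd
    obtain k where k: "k \<in> H" "\<forall>z\<in>X. k z = h (g z)" using mult_in[OF h snd(1)] by blast
    moreover have "\<not> (\<exists>g\<in>H. h z = g x)"
      using orbit_translate_iff[OF h z points(1)] snd(3) by blast
    ultimately show ?thesis
      using snd exchange_snd[OF k(1)] exchange_snd[OF snd(1)] points by simp
  next
    case other
    then show ?thesis
      using orbit_translate_iff[OF h z points(1)] orbit_translate_iff[OF h z points(2)]
      by (simp add: exchange_other)
  qed
qed

lemma flip: "same_stabilizer X H y x"
  using subgroup points stabilizer_eq by (simp add: same_stabilizer_def)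

text \<open>The inverse has \<open>x\<close> and \<open>y\<close> interchanged because the exchange
  need not be an involution when the two orbits coincide: then it sends every h x to h y, and its
  inverse sends h y back to h x.\<close>

lemma exchange_exchange:
  assumes z: "z \<in> X"
  shows "orbit_exchange H y x (orbit_exchange H x y z) = z"
proof -
  interpret flip: same_stabilizer X H y x by (rule flip)
  consider (fst) g where "g \<in> H" "z = g x"
    | (snd) g where "g \<in> H" "z = g y" "\<not> (\<exists>g\<in>H. z = g x)"
    | (other) "\<not> (\<exists>g\<in>H. z = g x)" "\<not> (\<exists>g\<in>H. z = g y)" by blast
  then show ?thesis
  proof cases
    case fst
    then show ?thesis by (simp add: exchange_fst flip.exchange_fst)
  next
    case snd
    \<comment> \<open>The orbits are disjoint here, so the reversed exchange also treats
      \<open>g x\<close> by its second case.\<close>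
    have "\<not> (\<exists>k\<in>H. g x = k y)"
      using snd orbit_translate_iff[OF snd(1) points] orbit_translate_iff[OF snd(1) points(2,1)]
        orbit_sym[OF points] by simp
    with snd show ?thesis by (simp add: exchange_snd flip.exchange_snd)
  next
    case other
    then show ?thesis by (simp add: exchange_other flip.exchange_other)
  qed
qed

lemma exchange_in_Bij: "restrict (orbit_exchange H x y) X \<in> Bij X"
proof -
  interpret flip: same_stabilizer X H y x by (rule flip)
  show ?thesis
    by (rule restrict_in_BijI[where g = "orbit_exchange H y x"])
      (simp_all add: exchange_closed flip.exchange_closed exchange_exchange flip.exchange_exchange)
qed

lemma exchange_base: "orbit_exchange H x y x = y"
  using one_in exchange_fst points by metis

end

section \<open>Pigeonhole on stabilizers in a countable group\<close>

lemma Pow_countable_lepoll_real: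
  assumes "countable A"
  shows "Pow A \<lesssim> (UNIV :: real set)"
proof -
  have "inj_on (image (to_nat_on A)) (Pow A)"
    using inj_on_to_nat_on[OF assms] by (rule inj_on_image_Pow)
  then have "Pow A \<lesssim> (UNIV :: nat set set)"
    unfolding lepoll_def by blast
  then show ?thesis using nat_sets_eqpoll_reals lepoll_trans2 by blast
qed

lemma countable_subgroup_centralizer_nontrivial:
  assumes "subgroup H (BijGroup X)" "countable H" "\<not> X \<lesssim> (UNIV :: real set)"
  shows "\<exists>f\<in>Bij X. (\<forall>h\<in>H. \<forall>z\<in>X. f (h z) = h (f z)) \<and> (\<exists>z\<in>X. f z \<noteq> z)"
proof -
  have "\<not> X \<lesssim> Pow H"
    using assms(3) Pow_countable_lepoll_real[OF assms(2)] lepoll_trans by blast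
  then have "\<not> inj_on (\<lambda>z. {h \<in> H. h z = z}) X"
    unfolding lepoll_def by blast
  then obtain x y where xy: "x \<in> X" "y \<in> X" "x \<noteq> y" "{h \<in> H. h x = x} = {h \<in> H. h y = y}"
    unfolding inj_on_def by blast
  interpret same_stabilizer X H x y
    using assms(1) xy by (auto simp: same_stabilizer_def)
  show ?thesis
  proof (intro bexI[OF _ exchange_in_Bij] conjI)
    show "\<forall>h\<in>H. \<forall>z\<in>X. restrict (orbit_exchange H x y) X (h z) = h (restrict (orbit_exchange H x y) X z)"
      by (simp add: closed exchange_commute)
    show "\<exists>z\<in>X. restrict (orbit_exchange H x y) X z \<noteq> z"
      using xy exchange_base by auto
  qed
qed

section \<open>Rigid finite sets of permutations\<close>

text \<open>If \<open>f\<close> moved \<open>p\<close>, the transposition of \<open>f p\<close> with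
  a third point \<open>r\<close> would fix \<open>p\<close>; commuting with it would give f p =
  r.\<close>

lemma BijGroup_center_trivial:
  assumes "{1..3::nat} \<lesssim> X" and f: "f \<in> Bij X"
    and comm: "\<And>b z. b \<in> Bij X \<Longrightarrow> z \<in> X \<Longrightarrow> f (b z) = b (f z)"
    and p: "p \<in> X"
  shows "f p = p"
proof (rule ccontr)
  assume ne: "f p \<noteq> p"
  have "\<not> X \<subseteq> {p, f p}"
  proof
    assume sub: "X \<subseteq> {p, f p}"
    then have "finite X" "card X \<le> card {p, f p}" by (auto intro: finite_subset card_mono)
    moreover have "card {p, f p} \<le> 2" by (simp add: card_insert_if)
    ultimately show False
      using assms(1) lepoll_iff_card_le[of "{1..3::nat}" X] by simp
  qed
  then obtain r where r: "r \<in> X" "r \<noteq> p" "r \<noteq> f p" by blast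
  have q: "f p \<in> X" using f p by (rule Bij_apply_closed)
  define t where "t z = (if z = f p then r else if z = r then f p else z)" for z
  have "restrict t X \<in> Bij X"
    by (rule restrict_in_BijI[where g = t]) (use r q in \<open>auto simp: t_def\<close>)
  from comm[OF this p] show False
    using p q r ne by (auto simp: t_def)
qed

section \<open>Shift and pair swaps on the fibres\<close>

text \<open>Members \<open>m\<close> of \<open>A\<close> stand for the pairs \<open>{2m, 2m + 1}\<close> to be exchanged.\<close>

definition pair_swap :: "int set \<Rightarrow> int \<Rightarrow> int"
  where "pair_swap A n = (if n div 2 \<in> A then (if even n then n + 1 else n - 1) else n)"

lemma pair_swap_div [simp]: "pair_swap A n div 2 = n div 2"
  unfolding pair_swap_def by (auto elim!: evenE oddE)

lemma pair_swap_involution [simp]: "pair_swap A (pair_swap A n) = n"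
proof -
  have "pair_swap A n div 2 = n div 2" by simp
  then show ?thesis
    by (auto simp: pair_swap_def split: if_splits)
qed

lemma pair_swap_fixed_iff: "pair_swap A n = n \<longleftrightarrow> n div 2 \<notin> A"
  by (auto simp: pair_swap_def)

text \<open>Stated in the product model, so that the identification with \<open>X\<close> enters
  only in the application. In \<open>swap_A\<close> the right side uses the set attached to the
  image fibre, which is what lets the sets of two fibres be compared.\<close>

lemma commute_shift_pair_swap_imp_id:
  fixes A :: "'a \<Rightarrow> int set" and f :: "'a \<times> int \<Rightarrow> 'a \<times> int"
  assumes inj_A: "inj_on A Y"
    and closed: "\<And>y n. y \<in> Y \<Longrightarrow> fst (f (y, n)) \<in> Y"
    and inj_f: "inj_on f (Y \<times> UNIV)"
    and shift: "\<And>y n. y \<in> Y \<Longrightarrow> f (y, n + 1) = map_prod id (\<lambda>n. n + 1) (f (y, n))"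
    and swap: "\<And>y n. y \<in> Y \<Longrightarrow> f (y, pair_swap {0} n) = map_prod id (pair_swap {0}) (f (y, n))"
    and swap_A: "\<And>y n. y \<in> Y \<Longrightarrow> f (y, pair_swap (A y) n) =
      (fst (f (y, n)), pair_swap (A (fst (f (y, n)))) (snd (f (y, n))))"
    and y: "y \<in> Y"
  shows "f (y, n) = (y, n)"
proof -
  obtain y' c where y'c: "f (y, 0) = (y', c)" by fastforce
  have trans: "f (y, n) = (y', c + n)" for n
  proof (induction n rule: int_induct[where k = 0])
    case base
    then show ?case using y'c by simp
  next
    case (step1 i)
    then show ?case using shift[OF y, of i] by simp
  next
    case (step2 i)
    then show ?case using shift[OF y, of "i - 1"] by (cases "f (y, i - 1)") auto
  qed
  have inj: "m = n" if "f (y, m) = f (y, n)" for m n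
    using inj_onD[OF inj_f that] y by simp
  \<comment> \<open>Commutation makes translation by \<open>c\<close> preserve the fixed points of
    \<open>pair_swap {0}\<close>, hence also {0, 1}, the set of points it moves.\<close>
  have zero: "(c + n) div 2 = 0 \<longleftrightarrow> n div 2 = 0" for n
  proof -
    have "pair_swap {0} n = n \<longleftrightarrow> pair_swap {0} (c + n) = c + n"
      using swap[OF y, of n] by (auto simp: trans)
    then show ?thesis by (simp add: pair_swap_fixed_iff)
  qed
  \<comment> \<open>The instance at 0 leaves c = 0 or c = 1, and the instance at 1 excludes c =
    1.\<close>
  have "c = 0" using zero[of 0] zero[of 1] by presburger
  \<comment> \<open>The number 2m represents the pair with index \<open>m\<close>, so whether it is
    fixed detects membership of \<open>m\<close>.\<close>
  have "m \<in> A y \<longleftrightarrow> m \<in> A y'" for m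
  proof -
    have "pair_swap (A y) (2 * m) = 2 * m \<longleftrightarrow> pair_swap (A y') (2 * m) = 2 * m"
      using swap_A[OF y, of "2 * m"] \<open>c = 0\<close> by (auto simp: trans)
    then show ?thesis by (simp add: pair_swap_fixed_iff)
  qed
  then have "A y = A y'" by blast
  moreover have "y' \<in> Y" using closed[OF y, of 0] y'c by simp
  ultimately have "y' = y" using inj_A y by (auto dest: inj_onD)
  with trans \<open>c = 0\<close> show ?thesis by simp
qed

section \<open>Transport from the product model to an infinite set\<close>

lemma infinite_eqpoll_times_int:
  assumes "infinite X"
  shows "X \<times> (UNIV :: int set) \<approx> X"
proof -
  have "(UNIV :: int set) \<lesssim> (UNIV :: nat set)"
    unfolding lepoll_def using inj_to_nat by blast
  also have "\<dots> \<lesssim> X" using assms infinite_le_lepoll by blast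
  finally have "(card_of (UNIV :: int set), card_of X) \<in> ordLeq"
    by (simp add: lepoll_def card_of_ordLeq)
  then show ?thesis
    unfolding eqpoll_iff_card_of_ordIso
    using card_of_Times_infinite[of X "UNIV :: int set"] assms by blast
qed

lemma lepoll_real_imp_inj_int_sets:
  assumes "X \<lesssim> (UNIV :: real set)"
  shows "\<exists>A :: 'a \<Rightarrow> int set. inj_on A (X :: 'a set)"
proof -
  have "X \<lesssim> (UNIV :: nat set set)"
    using assms nat_sets_eqpoll_reals by (meson eqpoll_sym lepoll_trans2)
  then obtain g :: "'a \<Rightarrow> nat set" where g: "inj_on g X"
    unfolding lepoll_def by blast
  have "inj_on (\<lambda>x. int ` g x) X"
    using g by (auto simp: inj_on_def inj_image_eq_iff)
  then show ?thesis by blast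
qed

lemma infinite_rigid_finite_set:
  fixes X :: "'a set"
  assumes "infinite X" "X \<lesssim> (UNIV :: real set)"
  shows "\<exists>F. finite F \<and> F \<subseteq> Bij X \<and>
    (\<forall>f\<in>Bij X. (\<forall>b\<in>F. \<forall>z\<in>X. f (b z) = b (f z)) \<longrightarrow> (\<forall>z\<in>X. f z = z))"
proof -
  obtain A :: "'a \<Rightarrow> int set" where A: "inj_on A X"
    using lepoll_real_imp_inj_int_sets[OF assms(2)] by blast
  \<comment> \<open>\<open>e\<close> and \<open>d\<close> are mutually inverse bijections between
    the product and \<open>X\<close>; \<open>lift\<close> conjugates by them.\<close>
  obtain e d where e: "\<And>w. w \<in> X \<times> (UNIV :: int set) \<Longrightarrow> e w \<in> X \<and> d (e w) = w"
    and d: "\<And>z. z \<in> X \<Longrightarrow> d z \<in> X \<times> (UNIV :: int set) \<and> e (d z) = z"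
    using infinite_eqpoll_times_int[OF assms(1)] unfolding eqpoll_iff_bijections by metis
  define lift where "lift p = restrict (\<lambda>z. e (p (d z))) X" for p
  have lift_apply: "lift p (e w) = e (p w)" if "w \<in> X \<times> UNIV" for p w
    using that e by (simp add: lift_def)
  have lift_Bij: "lift (\<lambda>(y, n). (y, p y n)) \<in> Bij X"
    if "\<And>y n. q y (p y n) = n" "\<And>y n. p y (q y n) = n" for p q :: "'a \<Rightarrow> int \<Rightarrow> int"
    unfolding lift_def
  proof (rule restrict_in_BijI[where g = "\<lambda>z. e (case d z of (y, n) \<Rightarrow> (y, q y n))"])
    fix z assume "z \<in> X"
    then obtain y n where "d z = (y, n)" "y \<in> X" "e (y, n) = z" using d by fastforce
    with e that show "e (case d z of (y, n) \<Rightarrow> (y, p y n)) \<in> X"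
      "e (case d z of (y, n) \<Rightarrow> (y, q y n)) \<in> X"
      "e (case d (e (case d z of (y, n) \<Rightarrow> (y, p y n))) of (y, n) \<Rightarrow> (y, q y n)) = z"
      "e (case d (e (case d z of (y, n) \<Rightarrow> (y, q y n))) of (y, n) \<Rightarrow> (y, p y n)) = z"
      by simp_all
  qed
  define F where "F = {lift (\<lambda>(y, n). (y, n + 1)), lift (\<lambda>(y, n). (y, pair_swap {0} n)),
    lift (\<lambda>(y, n). (y, pair_swap (A y) n))}"
  have "F \<subseteq> Bij X"
    unfolding F_def
    using lift_Bij[of "\<lambda>_ n. n - 1" "\<lambda>_ n. n + 1"]
      lift_Bij[of "\<lambda>_. pair_swap {0}" "\<lambda>_. pair_swap {0}"]
      lift_Bij[of "\<lambda>y. pair_swap (A y)" "\<lambda>y. pair_swap (A y)"] by simp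
  moreover have "f z = z"
    if f: "f \<in> Bij X" and comm: "\<forall>b\<in>F. \<forall>z\<in>X. f (b z) = b (f z)" and z: "z \<in> X" for f z
  proof -
    \<comment> \<open>The permutation \<open>f\<close> pulled back to the product model.\<close>
    define f' where "f' w = d (f (e w))" for w
    have f'_closed: "f' w \<in> X \<times> UNIV" if "w \<in> X \<times> UNIV" for w
      using that d e Bij_apply_closed[OF f] by (simp add: f'_def)
    have e_f': "e (f' w) = f (e w)" if "w \<in> X \<times> UNIV" for w
      using that d e Bij_apply_closed[OF f] by (simp add: f'_def)
    have inj: "inj_on f' (X \<times> UNIV)"
    proof (rule inj_onI)
      fix v w assume vw: "v \<in> X \<times> UNIV" "w \<in> X \<times> UNIV" "f' v = f' w"
      then have "f (e v) = f (e w)" using e_f' by metis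
      then show "v = w" using vw e Bij_apply_eq_iff[OF f] by metis
    qed
    \<comment> \<open>The closure conditions on \<open>p\<close> allow \<open>d\<close> to undo
      \<open>e\<close> at both \<open>p w\<close> and \<open>p (f' w)\<close>.\<close>
    have comm': "f' (p w) = p (f' w)"
      if p: "lift p \<in> F" "p w \<in> X \<times> UNIV" "p (f' w) \<in> X \<times> UNIV" and w: "w \<in> X \<times> UNIV" for p w
    proof -
      have "f (e (p w)) = f (lift p (e w))" using w by (simp add: lift_apply)
      also have "\<dots> = lift p (f (e w))" using comm p(1) e[OF w] by blast
      also have "\<dots> = lift p (e (f' w))" using e_f'[OF w] by simp
      also have "\<dots> = e (p (f' w))" using f'_closed[OF w] by (simp add: lift_apply)
      finally show ?thesis using e p by (simp add: f'_def)
    qed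
    obtain y n where yn: "d z = (y, n)" "y \<in> X" using d[OF z] by auto
    have "f' (y, n) = (y, n)"
    proof (rule commute_shift_pair_swap_imp_id[where A = A and Y = X])
      fix y n assume y: "y \<in> X"
      obtain y' n' where y'n': "f' (y, n) = (y', n')" "y' \<in> X"
        using f'_closed[of "(y, n)"] y by auto
      show "fst (f' (y, n)) \<in> X" using y'n' by simp
      show "f' (y, n + 1) = map_prod id (\<lambda>n. n + 1) (f' (y, n))"
        using comm'[of "\<lambda>(y, n). (y, n + 1)" "(y, n)"] y y'n' by (simp add: F_def)
      show "f' (y, pair_swap {0} n) = map_prod id (pair_swap {0}) (f' (y, n))"
        using comm'[of "\<lambda>(y, n). (y, pair_swap {0} n)" "(y, n)"] y y'n' by (simp add: F_def)
      show "f' (y, pair_swap (A y) n) =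
          (fst (f' (y, n)), pair_swap (A (fst (f' (y, n)))) (snd (f' (y, n))))"
        using comm'[of "\<lambda>(y, n). (y, pair_swap (A y) n)" "(y, n)"] y y'n' by (simp add: F_def)
    qed (use A inj yn in auto)
    then have "f (e (d z)) = e (d z)" using e_f'[of "d z"] yn by simp
    then show ?thesis using d[OF z] by simp
  qed
  moreover have "finite F" by (simp add: F_def)
  ultimately show ?thesis by (intro exI[of _ F]) simp
qed

lemma finite_Bij: "finite X \<Longrightarrow> finite (Bij X)"
  by (rule finite_subset[OF _ finite_PiE[of X "\<lambda>_. X"]])
    (auto simp: PiE_def Bij_imp_extensional Bij_apply_closed)

section \<open>The two directions combined\<close>

theorem theorem5p1:
  fixes X :: "'a set"
  assumes "{1..3::nat} \<lesssim> X"
  shows "centralizer_topology (BijGroup X) = discrete_topology (carrier (BijGroup X))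
    \<longleftrightarrow> X \<lesssim> (UNIV :: real set)"
  unfolding BijGroup_discrete_iff
proof (intro iffI)
  assume "\<exists>F. finite F \<and> F \<subseteq> Bij X \<and>
    (\<forall>f\<in>Bij X. (\<forall>b\<in>F. \<forall>z\<in>X. f (b z) = b (f z)) \<longrightarrow> (\<forall>z\<in>X. f z = z))"
  then obtain F where F: "finite F" "F \<subseteq> Bij X"
    and triv: "\<forall>f\<in>Bij X. (\<forall>b\<in>F. \<forall>z\<in>X. f (b z) = b (f z)) \<longrightarrow> (\<forall>z\<in>X. f z = z)"
    by (elim exE conjE)
  interpret group "BijGroup X" by (rule group_BijGroup)
  let ?H = "generate (BijGroup X) F"
  have H: "subgroup ?H (BijGroup X)" "countable ?H"
    using F by (simp_all add: generate_is_subgroup countable_generate countable_finite)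
  show "X \<lesssim> (UNIV :: real set)"
  proof (rule ccontr)
    assume "\<not> X \<lesssim> (UNIV :: real set)"
    from countable_subgroup_centralizer_nontrivial[OF H this] obtain f z
      where f: "f \<in> Bij X" "\<forall>h\<in>?H. \<forall>z\<in>X. f (h z) = h (f z)" and z: "z \<in> X" "f z \<noteq> z"
      by (elim bexE conjE)
    have "\<forall>b\<in>F. \<forall>z\<in>X. f (b z) = b (f z)"
      using f(2) generate.incl by fast
    with triv f(1) z show False by simp
  qed
next
  assume "X \<lesssim> (UNIV :: real set)"
  then show "\<exists>F. finite F \<and> F \<subseteq> Bij X \<and>
    (\<forall>f\<in>Bij X. (\<forall>b\<in>F. \<forall>z\<in>X. f (b z) = b (f z)) \<longrightarrow> (\<forall>z\<in>X. f z = z))"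
  proof (cases "finite X")
    case True
    then show ?thesis
      using BijGroup_center_trivial[OF assms]
      by (intro exI[of _ "Bij X"]) (simp add: finite_Bij)
  next
    case False
    with \<open>X \<lesssim> UNIV\<close> show ?thesis by (intro infinite_rigid_finite_set)
  qed
qed

end
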